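(* Let $M,N\ge 1$, let $G=(V,E)$ be a connected bipartite graph on node sets $V_1=\{0,\ldots,M-1\}$ and $V_2=\{M,\ldots,M+N-1\}$ (so $V=V_1\cup V_2$, $|V|=M+N$, and every edge has one endpoint in $V_1$ and one in $V_2$), let $\mathbf c\in\mathbb R^{|E|}$, and let $$P_{G,\mathbf c}=\{\mathbf u\in\mathbb R^{M+N} : -u_a+u_b\le c_{ab}\ \text{ for all } a\in V_1,\ b\in V_2 \text{ with } ab\in E,\ \ u_0=0\}$$ be the associated dual transportation polyhedron. Then the circuit diameter $\operatorname{diam}_{\mathcal C}(P_{G,\mathbf c})$ of $P_{G,\mathbf c}$ is bounded from above by $|V|-2$.
   Context: Circuits of $P_{G,\mathbf c}$. The set of circuits $\mathcal C_G$ associated to the polyhedron $P_{G,\mathbf c}$ is the set of all possible edge directions of $P_{G,\mathbf c'}$ for varying right-hand sides $\mathbf c'\in\mathbb R^{|E|}$ (with $G$ fixed). Explicitly: for every partition $V=R\cup S$, $R\cap S=\emptyset$, into nonempty node sets $R,S$ each of which induces a connected subgraph of $G$, with $0\in R$, let $\mathbf g^{R,S}\in\mathbb R^{M+N}$ be the vector with $g_i=0$ for $i\in R$ and $g_i=1$ for $i\in S$. Then $\mathcal C_G$ consists of exactly the vectors $\pm\mathbf g^{R,S}$ for all such partitions. Circuit walk. For two vertices $\mathbf v^{(1)},\mathbf v^{(2)}$ of a polyhedron $P$ with set of circuits $\mathcal C$, a sequence $\mathbf v^{(1)}=\mathbf y^{(0)},\ldots,\mathbf y^{(k)}=\mathbf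 v^{(2)}$ is a circuit walk of length $k$ if for all $i=0,\ldots,k-1$: (1) $\mathbf y^{(i)}\in P$; (2) $\mathbf y^{(i+1)}-\mathbf y^{(i)}=\alpha_i\mathbf g^{(i)}$ for some $\mathbf g^{(i)}\in\mathcal C$ and some $\alpha_i>0$; (3) $\mathbf y^{(i)}+\alpha\mathbf g^{(i)}\notin P$ for all $\alpha>\alpha_i$. Circuit distance and diameter. The circuit distance $\operatorname{dist}_{\mathcal C}(\mathbf v^{(1)},\mathbf v^{(2)})$ is the minimum length of a circuit walk from $\mathbf v^{(1)}$ to $\mathbf v^{(2)}$. The circuit diameter $\operatorname{diam}_{\mathcal C}(P)$ is the maximum circuit distance from $\mathbf v^{(1)}$ to $\mathbf v^{(2)}$ over all ordered pairs of vertices of $P$. For $P=P_{G,\mathbf c}$ one uses $\mathcal C=\mathcal C_G$. *)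

theory Defs
  imports "HOL-Analysis.Analysis" "HOL-Library.Extended_Nat"
begin

text \<open>
  A bipartite graph with node classes of sizes \<open>M, N \<ge> 1\<close> is given by its edge set
  \<open>E :: ('m \<times> 'n) set\<close> over two finite index types of cardinalities \<open>M\<close> and \<open>N\<close>. The node type is
  the sum \<open>'m + 'n\<close>, with \<open>Inl\<close> for \<open>V\<^sub>1\<close> and \<open>Inr\<close> for \<open>V\<^sub>2\<close>, so that points of
  \<open>\<real>\<^bsup>M+N\<^esup>\<close> have type \<open>real ^ ('m + 'n)\<close>. The index types carry no distinguished element; the node
  called \<open>0 \<in> V\<^sub>1\<close> is a parameter \<open>r :: 'm\<close>.
\<close>

definition adjacency :: "('m \<times> 'n) set \<Rightarrow> (('m + 'n) \<times> ('m + 'n)) set" where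
  "adjacency E = (\<Union>(a, b)\<in>E. {(Inl a, Inr b), (Inr b, Inl a)})"

text \<open>The empty node set counts as connected here; nonemptiness is required separately below.\<close>

definition induces_connected :: "('m \<times> 'n) set \<Rightarrow> ('m + 'n) set \<Rightarrow> bool" where
  "induces_connected E W \<longleftrightarrow> (\<forall>x\<in>W. \<forall>y\<in>W. (x, y) \<in> (adjacency E \<inter> W \<times> W)\<^sup>*)"

text \<open>Only the values of \<open>c\<close> on \<open>E\<close> matter.\<close>

definition dual_transportation_polyhedron ::
    "('m::finite \<times> 'n::finite) set \<Rightarrow> ('m \<times> 'n \<Rightarrow> real) \<Rightarrow> 'm \<Rightarrow> (real ^ ('m + 'n)) set" where
  "dual_transportation_polyhedron E c r =
     {u. (\<forall>(a, b)\<in>E. - u $ Inl a + u $ Inr b \<le> c (a, b)) \<and> u $ Inl r = 0}"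

definition cut_vector :: "('m::finite + 'n::finite) set \<Rightarrow> real ^ ('m + 'n)" where
  "cut_vector S = (\<chi> i. if i \<in> S then 1 else 0)"

definition dual_transportation_circuits ::
    "('m::finite \<times> 'n::finite) set \<Rightarrow> 'm \<Rightarrow> (real ^ ('m + 'n)) set" where
  "dual_transportation_circuits E r =
     {g. \<exists>R S. R \<union> S = UNIV \<and> R \<inter> S = {} \<and> R \<noteq> {} \<and> S \<noteq> {} \<and>
           induces_connected E R \<and> induces_connected E S \<and> Inl r \<in> R \<and>
           (g = cut_vector S \<or> g = - cut_vector S)}"

definition circuit_walk ::
    "'a::real_vector set \<Rightarrow> 'a set \<Rightarrow> 'a \<Rightarrow> 'a \<Rightarrow> nat \<Rightarrow> (nat \<Rightarrow> 'a) \<Rightarrow> bool" where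
  "circuit_walk P C v w k y \<longleftrightarrow>
     y 0 = v \<and> y k = w \<and>
     (\<forall>i<k. y i \<in> P \<and>
        (\<exists>g\<in>C. \<exists>\<alpha>>0. y (Suc i) - y i = \<alpha> *\<^sub>R g \<and> (\<forall>\<beta>>\<alpha>. y i + \<beta> *\<^sub>R g \<notin> P)))"

text \<open>The distance is \<open>\<infinity>\<close> if there is no circuit walk from \<open>v\<close> to \<open>w\<close>.\<close>

definition circuit_dist :: "'a::real_vector set \<Rightarrow> 'a set \<Rightarrow> 'a \<Rightarrow> 'a \<Rightarrow> enat" where
  "circuit_dist P C v w = Inf {enat k | k. \<exists>y. circuit_walk P C v w k y}"

definition circuit_diameter :: "'a::real_vector set \<Rightarrow> 'a set \<Rightarrow> enat" where
  "circuit_diameter P C =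
     Sup {circuit_dist P C v w | v w. v extreme_point_of P \<and> w extreme_point_of P}"

end

(*
  Write d = w - u for the current point u and the target vertex w. An edge ab of slack s at u has
  slack s + d_a - d_b \<ge> 0 at w. Every node lies on an edge that is tight at a given vertex, and at
  a node where d is maximal this forces an edge tight at both endpoints of the walk, so the walk
  starts with a connected set K of two nodes on which d is constant. As long as K is not everything,
  the tight edges of w cross K; say a in K, b not in K, with slack \<alpha> = d_b - d_a at u. Raising
  the star S of b together with its neighbours outside K along edges of slack below \<alpha> makes ab
  tight: no edge from K to b has slack below d_b - d_a = \<alpha>, so the step stops exactly there
  and b joins K. The components of V - S not containing K are raised along with S, which turns S
  into one side of a circuit without creating new blocking edges. Hence |V| - 2 steps suffice.
*)
theory Submission
  imports Defs
begin

section \<open>Connected node sets\<close>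

lemma adjacency_simps [simp]:
  "(Inl a, Inr b) \<in> adjacency E \<longleftrightarrow> (a, b) \<in> E"
  "(Inr b, Inl a) \<in> adjacency E \<longleftrightarrow> (a, b) \<in> E"
  by (auto simp: adjacency_def)

lemma adjacency_sym: "(x, y) \<in> adjacency E \<Longrightarrow> (y, x) \<in> adjacency E"
  by (auto simp: adjacency_def)

text \<open>A path that leaves A must use an edge from A to \<open>W - A\<close>; conversely, the
  set reachable from a node inside W has no edge to the rest of W, so it is all of W. The cut form
  lets later connectivity proofs argue by cases on A instead of building paths.\<close>

lemma induces_connected_iff_cut:
  "induces_connected E W \<longleftrightarrow>
     (\<forall>A\<subseteq>W. A \<noteq> {} \<longrightarrow> A \<noteq> W \<longrightarrow> (\<exists>x\<in>A. \<exists>y\<in>W - A. (x, y) \<in> adjacency E))"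
proof (intro iffI allI impI)
  fix A assume con: "induces_connected E W" and A: "A \<subseteq> W" "A \<noteq> {}" "A \<noteq> W"
  obtain x y where xy: "x \<in> A" "y \<in> W - A" using A by blast
  then have "(x, y) \<in> (adjacency E \<inter> W \<times> W)\<^sup>*"
    using con A by (auto simp: induces_connected_def)
  then have "y \<in> A \<or> (\<exists>x\<in>A. \<exists>y\<in>W - A. (x, y) \<in> adjacency E)"
    by (induction rule: rtrancl_induct) (use xy in blast)+
  then show "\<exists>x\<in>A. \<exists>y\<in>W - A. (x, y) \<in> adjacency E" using xy by blast
next
  assume cut: "\<forall>A\<subseteq>W. A \<noteq> {} \<longrightarrow> A \<noteq> W \<longrightarrow> (\<exists>x\<in>A. \<exists>y\<in>W - A. (x, y) \<in> adjacency E)"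
  show "induces_connected E W"
    unfolding induces_connected_def
  proof (intro ballI)
    fix x y assume xy: "x \<in> W" "y \<in> W"
    define A where "A = {z \<in> W. (x, z) \<in> (adjacency E \<inter> W \<times> W)\<^sup>*}"
    have "A = W"
    proof (rule ccontr)
      assume "A \<noteq> W"
      moreover have "A \<subseteq> W" "x \<in> A" using xy by (auto simp: A_def)
      ultimately obtain p q where pq: "p \<in> A" "q \<in> W - A" "(p, q) \<in> adjacency E"
        using cut by blast
      then have "(p, q) \<in> adjacency E \<inter> W \<times> W" by (auto simp: A_def)
      with pq(1) have "(x, q) \<in> (adjacency E \<inter> W \<times> W)\<^sup>*"
        by (auto simp: A_def intro: rtrancl_into_rtrancl)
      with pq(2) show False by (auto simp: A_def)
    qed
    then show "(x, y) \<in> (adjacency E \<inter> W \<times> W)\<^sup>*" using xy by (auto simp: A_def)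
  qed
qed

lemma induces_connected_star:
  assumes "z \<in> W" "\<And>x. x \<in> W \<Longrightarrow> x \<noteq> z \<Longrightarrow> (z, x) \<in> adjacency E"
  shows "induces_connected E W"
  unfolding induces_connected_iff_cut
proof (intro allI impI)
  fix A assume A: "A \<subseteq> W" "A \<noteq> {}" "A \<noteq> W"
  show "\<exists>x\<in>A. \<exists>y\<in>W - A. (x, y) \<in> adjacency E"
  proof (cases "z \<in> A")
    case True
    then show ?thesis using A assms(2) by blast
  next
    case False
    obtain x where x: "x \<in> A" using A by blast
    then have "(z, x) \<in> adjacency E" using A False assms(2) by blast
    then show ?thesis using x False assms(1) adjacency_sym by blast
  qed
qed

lemma induces_connected_insert:
  assumes con: "induces_connected E W" and x: "x \<in> W" "(x, z) \<in> adjacency E"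
  shows "induces_connected E (insert z W)"
  unfolding induces_connected_iff_cut
proof (intro allI impI)
  fix A assume A: "A \<subseteq> insert z W" "A \<noteq> {}" "A \<noteq> insert z W"
  show "\<exists>p\<in>A. \<exists>q\<in>insert z W - A. (p, q) \<in> adjacency E"
  proof (cases "A \<inter> W = {} \<or> W \<subseteq> A")
    case True
    then show ?thesis using A x adjacency_sym[OF x(2)] by blast
  next
    case False
    then have "A \<inter> W \<subseteq> W" "A \<inter> W \<noteq> {}" "A \<inter> W \<noteq> W" by auto
    then obtain p q where "p \<in> A \<inter> W" "q \<in> W - A \<inter> W" "(p, q) \<in> adjacency E"
      using con unfolding induces_connected_iff_cut by blast
    then show ?thesis by blast
  qed
qed

text \<open>X is the component of the complement of S that contains K, obtained as a maximal
  connected set. By maximality every edge leaving X ends in S. Thus a connected S extends to one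
  side of a circuit, and only edges ending in S can block a step across the partition.\<close>

lemma separating_partition:
  fixes E :: "('m::finite \<times> 'n::finite) set"
  assumes con: "induces_connected E UNIV"
    and K: "induces_connected E K" "K \<noteq> {}"
    and S: "induces_connected E S" "S \<noteq> {}" and disj: "K \<inter> S = {}"
  obtains X Y where "X \<union> Y = UNIV" "X \<inter> Y = {}" "K \<subseteq> X" "S \<subseteq> Y"
    "induces_connected E X" "induces_connected E Y"
    "\<And>x y. x \<in> X \<Longrightarrow> y \<in> Y \<Longrightarrow> (x, y) \<in> adjacency E \<Longrightarrow> y \<in> S"
proof -
  have "finite {X. K \<subseteq> X \<and> X \<inter> S = {} \<and> induces_connected E X}" by simp
  then obtain X where "X \<in> {X. K \<subseteq> X \<and> X \<inter> S = {} \<and> induces_connected E X}"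
    and maximal: "\<And>X'. X' \<in> {X. K \<subseteq> X \<and> X \<inter> S = {} \<and> induces_connected E X} \<Longrightarrow> X \<subseteq> X' \<Longrightarrow> X' = X"
    using finite_has_maximal2[of "{X. K \<subseteq> X \<and> X \<inter> S = {} \<and> induces_connected E X}" K] K disj
    by (smt (verit) mem_Collect_eq order_refl)
  then have X: "K \<subseteq> X" "X \<inter> S = {}" "induces_connected E X" by auto
  have leave: "y \<in> S" if "x \<in> X" "y \<in> - X" "(x, y) \<in> adjacency E" for x y
  proof (rule ccontr)
    assume "y \<notin> S"
    then have "insert y X = X"
      using that X by (intro maximal) (auto intro: induces_connected_insert)
    then show False using that by blast
  qed
  have "induces_connected E (- X)"
    unfolding induces_connected_iff_cut
  proof (intro allI impI)
    \<comment> \<open>Connectivity of the whole graph gives an edge out of B. It cannot end in X,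
      since edges leaving X land in S and B avoids S.\<close>
    have cross: "\<exists>p\<in>B. \<exists>q\<in>- X - B. (p, q) \<in> adjacency E"
      if "B \<subseteq> - X" "B \<noteq> {}" "B \<inter> S = {}" for B
    proof -
      have "B \<noteq> UNIV" using that S by auto
      then obtain p q where pq: "p \<in> B" "q \<in> UNIV - B" "(p, q) \<in> adjacency E"
        using con \<open>B \<noteq> {}\<close> unfolding induces_connected_iff_cut by blast
      then have "q \<notin> X" using that leave[of q p] adjacency_sym by blast
      then show ?thesis using pq by blast
    qed
    fix A assume A: "A \<subseteq> - X" "A \<noteq> {}" "A \<noteq> - X"
    \<comment> \<open>If A or its complement within \<open>- X\<close> misses S, then
      \<open>cross\<close> applies to that set; otherwise A splits S, and connectivity of S supplies
      the edge.\<close>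
    consider "A \<inter> S = {}" | "S \<subseteq> A" | "A \<inter> S \<noteq> {}" "A \<inter> S \<noteq> S" by blast
    then show "\<exists>p\<in>A. \<exists>q\<in>- X - A. (p, q) \<in> adjacency E"
    proof cases
      case 1
      then show ?thesis using cross A by blast
    next
      case 2
      have "- X - A \<subseteq> - X" "- X - A \<noteq> {}" "(- X - A) \<inter> S = {}" using A 2 by auto
      from cross[OF this] obtain p q
        where "p \<in> - X - A" "q \<in> - X - (- X - A)" "(p, q) \<in> adjacency E" by blast
      then show ?thesis using adjacency_sym by blast
    next
      case 3
      then obtain p q where "p \<in> A \<inter> S" "q \<in> S - A \<inter> S" "(p, q) \<in> adjacency E"
        using S unfolding induces_connected_iff_cut by (metis inf_le2)
      then show ?thesis using X by blast
    qed
  qed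
  then show thesis using X leave by (intro that[of X "- X"]) auto
qed

section \<open>Vertices and circuit steps\<close>

lemma mem_dual_transportation_polyhedron:
  "u \<in> dual_transportation_polyhedron E c r \<longleftrightarrow>
     (\<forall>a b. (a, b) \<in> E \<longrightarrow> 0 \<le> c (a, b) + u $ Inl a - u $ Inr b) \<and> u $ Inl r = 0"
  by (force simp: dual_transportation_polyhedron_def algebra_simps)

text \<open>Without a tight edge across the cut, one side could be shifted slightly both up and down
  within the polyhedron, making w the midpoint of a segment. Equivalently, the edges tight at a
  vertex form a connected spanning subgraph.\<close>

lemma extreme_point_tight_crossing_edge:
  fixes E :: "('m::finite \<times> 'n::finite) set"
  assumes ext: "w extreme_point_of dual_transportation_polyhedron E c r"
    and A: "A \<noteq> {}" "A \<noteq> UNIV"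
  obtains a b where "(a, b) \<in> E" "c (a, b) + w $ Inl a - w $ Inr b = 0" "Inl a \<in> A \<longleftrightarrow> Inr b \<notin> A"
proof -
  let ?P = "dual_transportation_polyhedron E c r"
  \<comment> \<open>The shifted side must avoid \<open>Inl r\<close> to keep that coordinate 0.
    Crossing is symmetric under complement, so either A or \<open>- A\<close> serves as S.\<close>
  have *: "\<exists>a b. (a, b) \<in> E \<and> c (a, b) + w $ Inl a - w $ Inr b = 0 \<and> (Inl a \<in> S \<longleftrightarrow> Inr b \<notin> S)"
    if S: "S \<noteq> {}" "Inl r \<notin> S" for S
  proof (rule ccontr)
    assume no: "\<not> ?thesis"
    define slack where "slack = (\<lambda>(a, b). c (a, b) + w $ Inl a - w $ Inr b)"
    define T where "T = slack ` {(a, b) \<in> E. Inl a \<in> S \<longleftrightarrow> Inr b \<notin> S}"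
    \<comment> \<open>The inserted 1 keeps the minimum defined and positive when no edge crosses
      S.\<close>
    define \<epsilon> where "\<epsilon> = Min (insert 1 T)"
    have w: "w \<in> ?P" using ext by (simp add: extreme_point_of_def)
    have "\<forall>t\<in>T. 0 < t"
      using w no by (fastforce simp: T_def slack_def mem_dual_transportation_polyhedron less_le)
    then have \<epsilon>: "\<epsilon> > 0" by (auto simp: \<epsilon>_def T_def)
    have le: "\<epsilon> \<le> c (a, b) + w $ Inl a - w $ Inr b"
      if "(a, b) \<in> E" "Inl a \<in> S \<longleftrightarrow> Inr b \<notin> S" for a b
    proof -
      have "slack (a, b) \<in> T" using that by (auto simp: T_def)
      then have "\<epsilon> \<le> slack (a, b)" by (auto simp: \<epsilon>_def T_def intro: Min_le)
      then show ?thesis by (simp add: slack_def)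
    qed
    have mem: "w + t *\<^sub>R cut_vector S \<in> ?P" if "\<bar>t\<bar> \<le> \<epsilon>" for t
      unfolding mem_dual_transportation_polyhedron
    proof (intro conjI allI impI)
      fix a b assume ab: "(a, b) \<in> E"
      then have "0 \<le> c (a, b) + w $ Inl a - w $ Inr b"
        using w by (simp add: mem_dual_transportation_polyhedron)
      then show "0 \<le> c (a, b) + (w + t *\<^sub>R cut_vector S) $ Inl a - (w + t *\<^sub>R cut_vector S) $ Inr b"
        using le[OF ab] that by (auto simp: cut_vector_def)
    qed (use w S in \<open>auto simp: mem_dual_transportation_polyhedron cut_vector_def\<close>)
    obtain i where "i \<in> S" using S by blast
    then have "cut_vector S $ i = 1" by (simp add: cut_vector_def)
    then have ne: "cut_vector S \<noteq> 0" by auto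
    have "w = (1/2) *\<^sub>R (w + \<epsilon> *\<^sub>R cut_vector S) + (1/2) *\<^sub>R (w + (- \<epsilon>) *\<^sub>R cut_vector S)"
      by (simp add: vec_eq_iff field_simps)
    moreover have "w + \<epsilon> *\<^sub>R cut_vector S \<noteq> w + (- \<epsilon>) *\<^sub>R cut_vector S"
      using \<epsilon> ne by (auto simp del: scaleR_minus_left)
    ultimately have "w \<in> open_segment (w + \<epsilon> *\<^sub>R cut_vector S) (w + (- \<epsilon>) *\<^sub>R cut_vector S)"
      unfolding in_segment by (intro conjI exI[of _ "1/2"]) auto
    moreover have "w + \<epsilon> *\<^sub>R cut_vector S \<in> ?P" "w + (- \<epsilon>) *\<^sub>R cut_vector S \<in> ?P"
      using \<epsilon> by (auto intro: mem simp del: scaleR_minus_left)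
    ultimately show False using ext unfolding extreme_point_of_def by blast
  qed
  show thesis
  proof (cases "Inl r \<in> A")
    case True
    then show thesis using *[of "- A"] A that by auto
  next
    case False
    then show thesis using *[of A] A that by auto
  qed
qed

text \<open>The condition of \<open>circuit_walk\<close> at a single index, isolated so that walks
  can be built by prepending steps.\<close>

definition circuit_step :: "'a::real_vector set \<Rightarrow> 'a set \<Rightarrow> 'a \<Rightarrow> 'a \<Rightarrow> bool" where
  "circuit_step P C y y' \<longleftrightarrow>
     y \<in> P \<and> (\<exists>g\<in>C. \<exists>\<alpha>>0. y' - y = \<alpha> *\<^sub>R g \<and> (\<forall>\<beta>>\<alpha>. y + \<beta> *\<^sub>R g \<notin> P))"

lemma circuit_walk_Cons:
  assumes "circuit_step P C y y'" "circuit_walk P C y' w k z"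
  shows "circuit_walk P C y w (Suc k) (case_nat y z)"
  using assms by (auto simp: circuit_walk_def circuit_step_def split: nat.split)

text \<open>
  Raising \<open>Y\<close> and lowering \<open>X\<close> differ by a multiple of the all-ones vector, which the
  normalization at \<open>r\<close> absorbs in \<open>t\<close>.
\<close>

lemma circuit_step_partition:
  fixes E :: "('m::finite \<times> 'n::finite) set"
  assumes y: "y \<in> dual_transportation_polyhedron E c r"
    and part: "X \<union> Y = UNIV" "X \<inter> Y = {}" "X \<noteq> {}" "Y \<noteq> {}"
    and con: "induces_connected E X" "induces_connected E Y"
    and \<alpha>: "\<alpha> > 0"
    and le: "\<And>a b. (a, b) \<in> E \<Longrightarrow> Inl a \<in> X \<Longrightarrow> Inr b \<in> Y \<Longrightarrow> \<alpha> \<le> c (a, b) + y $ Inl a - y $ Inr b"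
    and eq: "(a0, b0) \<in> E" "Inl a0 \<in> X" "Inr b0 \<in> Y" "\<alpha> = c (a0, b0) + y $ Inl a0 - y $ Inr b0"
  obtains y' t where "y' \<in> dual_transportation_polyhedron E c r"
    "circuit_step (dual_transportation_polyhedron E c r) (dual_transportation_circuits E r) y y'"
    "\<And>v. y' $ v = y $ v + (if v \<in> Y then \<alpha> else 0) + t"
proof -
  let ?P = "dual_transportation_polyhedron E c r"
  define g :: "real ^ ('m + 'n)" where "g = (if Inl r \<in> X then cut_vector Y else - cut_vector X)"
  define t where "t = (if Inl r \<in> X then 0 else (-1::real))"
  have iff: "v \<in> X \<longleftrightarrow> v \<notin> Y" for v using part by blast
  have g: "g $ v = (if v \<in> Y then 1 else 0) + t" for v
    by (auto simp: g_def t_def cut_vector_def iff)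
  have gr: "g $ Inl r = 0" by (auto simp: g t_def iff)
  have gC: "g \<in> dual_transportation_circuits E r"
  proof (cases "Inl r \<in> X")
    case True
    moreover have "g = cut_vector Y" using True by (simp add: g_def)
    ultimately show ?thesis
      using part con unfolding dual_transportation_circuits_def by blast
  next
    case False
    then have "Inl r \<in> Y" by (simp add: iff)
    moreover have "Y \<union> X = UNIV" "Y \<inter> X = {}" using part by auto
    moreover have "g = - cut_vector X" using False by (simp add: g_def)
    ultimately show ?thesis
      using part con unfolding dual_transportation_circuits_def by blast
  qed
  \<comment> \<open>Edges with \<open>Inl\<close> end in X and \<open>Inr\<close> end in Y lose
    slack \<alpha>; those oriented the other way gain \<alpha>, and edges within one side are
    unchanged.\<close>
  have mem: "y + \<alpha> *\<^sub>R g \<in> ?P"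
    unfolding mem_dual_transportation_polyhedron
  proof (intro conjI allI impI)
    fix a b assume ab: "(a, b) \<in> E"
    then have "0 \<le> c (a, b) + y $ Inl a - y $ Inr b"
      using y by (simp add: mem_dual_transportation_polyhedron)
    then show "0 \<le> c (a, b) + (y + \<alpha> *\<^sub>R g) $ Inl a - (y + \<alpha> *\<^sub>R g) $ Inr b"
      using le[OF ab] \<alpha> by (auto simp: g iff algebra_simps)
  qed (use y gr in \<open>simp add: mem_dual_transportation_polyhedron\<close>)
  \<comment> \<open>The edge \<open>(a0, b0)\<close> has slack exactly \<alpha> at y, so a longer
    step leaves it the negative slack \<alpha> - \<beta>.\<close>
  have max: "y + \<beta> *\<^sub>R g \<notin> ?P" if "\<beta> > \<alpha>" for \<beta>
  proof
    assume "y + \<beta> *\<^sub>R g \<in> ?P"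
    then have "0 \<le> c (a0, b0) + (y + \<beta> *\<^sub>R g) $ Inl a0 - (y + \<beta> *\<^sub>R g) $ Inr b0"
      using eq(1) unfolding mem_dual_transportation_polyhedron by blast
    then show False using that eq by (auto simp: g iff algebra_simps)
  qed
  have "circuit_step ?P (dual_transportation_circuits E r) y (y + \<alpha> *\<^sub>R g)"
    unfolding circuit_step_def using y gC \<alpha> max by (intro conjI bexI[of _ g] exI[of _ \<alpha>]) auto
  then show thesis using mem by (intro that[of "y + \<alpha> *\<^sub>R g" "\<alpha> * t"]) (auto simp: g algebra_simps)
qed

section \<open>Growing the settled node set\<close>

text \<open>K is settled when its nodes agree on the remaining displacement. That common value need
  not be 0, because the normalization at r may shift all coordinates. Since K lies on one side of
  the partition, it stays settled, and the step length is chosen so that the new node catches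
  up.\<close>

lemma settle_one_more_node:
  fixes E :: "('m::finite \<times> 'n::finite) set" and r :: 'm
  defines "C \<equiv> dual_transportation_circuits E r"
  assumes P: "P = dual_transportation_polyhedron E c r"
    and con: "induces_connected E UNIV"
    and w: "w extreme_point_of P" and y: "y \<in> P"
    and K: "induces_connected E K" "K \<noteq> {}" "K \<noteq> UNIV"
    and const: "\<And>v. v \<in> K \<Longrightarrow> w $ v - y $ v = \<delta>"
  obtains y' z \<delta>' where "y' \<in> P" "y' = y \<or> circuit_step P C y y'" "z \<notin> K"
    "induces_connected E (insert z K)" "\<And>v. v \<in> insert z K \<Longrightarrow> w $ v - y' $ v = \<delta>'"
proof -
  have slack_w: "0 \<le> c (a, b) + w $ Inl a - w $ Inr b"
    and slack_y: "0 \<le> c (a, b) + y $ Inl a - y $ Inr b" if "(a, b) \<in> E" for a b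
    using w y that by (auto simp: extreme_point_of_def P mem_dual_transportation_polyhedron)
  obtain a b where ab: "(a, b) \<in> E" "c (a, b) + w $ Inl a - w $ Inr b = 0" "Inl a \<in> K \<longleftrightarrow> Inr b \<notin> K"
    using extreme_point_tight_crossing_edge[OF w[unfolded P] K(2,3)] by blast
  \<comment> \<open>As ab is tight at w, its slack at y equals the displacement at b minus the
    displacement at a. If it is 0, the new node is settled without any step.\<close>
  define \<alpha> where "\<alpha> = c (a, b) + y $ Inl a - y $ Inr b"
  show thesis
  proof (cases "Inl a \<in> K")
    case True
    then have aK: "Inl a \<in> K" and bK: "Inr b \<notin> K" using ab by auto
    have insert: "induces_connected E (insert (Inr b) K)"
      using K aK ab by (intro induces_connected_insert[of _ _ "Inl a"]) auto
    have wb: "w $ Inr b - y $ Inr b = \<delta> + \<alpha>" using const[OF aK] ab(2) by (simp add: \<alpha>_def)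
    show thesis
    proof (cases "\<alpha> = 0")
      case True
      then show thesis using y bK insert wb const by (intro that[of y "Inr b" \<delta>]) auto
    next
      case False
      then have \<alpha>: "\<alpha> > 0" using slack_y[OF ab(1)] by (simp add: \<alpha>_def)
      \<comment> \<open>Neighbours of b outside K whose edges would become tight too early are moved
        together with b.\<close>
      define S where "S = insert (Inr b)
        {Inl a' | a'. Inl a' \<notin> K \<and> (a', b) \<in> E \<and> c (a', b) + y $ Inl a' - y $ Inr b < \<alpha>}"
      have "induces_connected E S"
        by (rule induces_connected_star[of "Inr b"]) (auto simp: S_def)
      moreover have "S \<noteq> {}" "K \<inter> S = {}" using bK by (auto simp: S_def)
      ultimately obtain X Y where XY: "X \<union> Y = UNIV" "X \<inter> Y = {}" "K \<subseteq> X" "S \<subseteq> Y"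
        "induces_connected E X" "induces_connected E Y"
        and leave: "\<And>x y. x \<in> X \<Longrightarrow> y \<in> Y \<Longrightarrow> (x, y) \<in> adjacency E \<Longrightarrow> y \<in> S"
        using separating_partition[OF con K(1,2)] by metis
      have bY: "Inr b \<in> Y" using XY by (auto simp: S_def)
      have le: "\<alpha> \<le> c (a', b') + y $ Inl a' - y $ Inr b'"
        if e: "(a', b') \<in> E" "Inl a' \<in> X" "Inr b' \<in> Y" for a' b'
      proof -
        have "Inr b' \<in> S" using leave e by auto
        then have b': "b' = b" by (auto simp: S_def)
        show ?thesis
        proof (cases "Inl a' \<in> K")
          case True
          \<comment> \<open>From y to w this edge loses exactly \<alpha>, and its slack at w is
            nonnegative.\<close>
          then show ?thesis using const[OF True] wb slack_w[OF e(1)] unfolding b' by linarith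
        next
          case False
          have "Inl a' \<notin> S" using e XY by blast
          then show ?thesis using False e b' by (auto simp: S_def)
        qed
      qed
      have ne: "X \<noteq> {}" "Y \<noteq> {}" "Inl a \<in> X" using XY K bY aK by auto
      obtain y' t where y': "y' \<in> P" "circuit_step P C y y'"
        "\<And>v. y' $ v = y $ v + (if v \<in> Y then \<alpha> else 0) + t"
        by (rule circuit_step_partition[OF y[unfolded P] XY(1,2) ne(1,2) XY(5,6) \<alpha> le
              ab(1) ne(3) bY \<alpha>_def, folded P C_def]; (assumption | rule that))
      \<comment> \<open>Nodes of K move by t and b moves by \<alpha> + t, which cancels the excess
        \<alpha> of b.\<close>
      have "w $ v - y' $ v = \<delta> - t" if "v \<in> insert (Inr b) K" for v
        using that const[of v] wb bY XY(2,3) by (auto simp: y'(3))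
      then show thesis using y' bK insert by (intro that[of y' "Inr b" "\<delta> - t"]) auto
    qed
  next
    \<comment> \<open>Mirror image: now a is the new node and its displacement is \<alpha> below
      that of K. The star is centred at a, and the side X containing K is raised instead of
      Y.\<close>
    case False
    then have aK: "Inl a \<notin> K" and bK: "Inr b \<in> K" using ab by auto
    have insert: "induces_connected E (insert (Inl a) K)"
      using K bK ab by (intro induces_connected_insert[of _ _ "Inr b"]) auto
    have wa: "w $ Inl a - y $ Inl a = \<delta> - \<alpha>" using const[OF bK] ab(2) by (simp add: \<alpha>_def)
    show thesis
    proof (cases "\<alpha> = 0")
      case True
      then show thesis using y aK insert wa const by (intro that[of y "Inl a" \<delta>]) auto
    next
      case False
      then have \<alpha>: "\<alpha> > 0" using slack_y[OF ab(1)] by (simp add: \<alpha>_def)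
      define S where "S = insert (Inl a)
        {Inr b' | b'. Inr b' \<notin> K \<and> (a, b') \<in> E \<and> c (a, b') + y $ Inl a - y $ Inr b' < \<alpha>}"
      have "induces_connected E S"
        by (rule induces_connected_star[of "Inl a"]) (auto simp: S_def)
      moreover have "S \<noteq> {}" "K \<inter> S = {}" using aK by (auto simp: S_def)
      ultimately obtain X Y where XY: "X \<union> Y = UNIV" "X \<inter> Y = {}" "K \<subseteq> X" "S \<subseteq> Y"
        "induces_connected E X" "induces_connected E Y"
        and leave: "\<And>x y. x \<in> X \<Longrightarrow> y \<in> Y \<Longrightarrow> (x, y) \<in> adjacency E \<Longrightarrow> y \<in> S"
        using separating_partition[OF con K(1,2)] by metis
      have YX: "Y \<union> X = UNIV" "Y \<inter> X = {}" using XY by auto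
      have aY: "Inl a \<in> Y" using XY by (auto simp: S_def)
      have le: "\<alpha> \<le> c (a', b') + y $ Inl a' - y $ Inr b'"
        if e: "(a', b') \<in> E" "Inl a' \<in> Y" "Inr b' \<in> X" for a' b'
      proof -
        have "Inl a' \<in> S" using leave e by auto
        then have a': "a' = a" by (auto simp: S_def)
        show ?thesis
        proof (cases "Inr b' \<in> K")
          case True
          then show ?thesis using const[OF True] wa slack_w[OF e(1)] unfolding a' by linarith
        next
          case False
          have "Inr b' \<notin> S" using e XY by blast
          then show ?thesis using False e a' by (auto simp: S_def)
        qed
      qed
      have ne: "Y \<noteq> {}" "X \<noteq> {}" "Inr b \<in> X" using XY K aY bK by auto
      obtain y' t where y': "y' \<in> P" "circuit_step P C y y'"
        "\<And>v. y' $ v = y $ v + (if v \<in> X then \<alpha> else 0) + t"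
        by (rule circuit_step_partition[OF y[unfolded P] YX ne(1,2) XY(6,5) \<alpha> le
              ab(1) aY ne(3) \<alpha>_def, folded P C_def]; (assumption | rule that))
      have "w $ v - y' $ v = \<delta> - \<alpha> - t" if "v \<in> insert (Inl a) K" for v
        using that const[of v] wa aY XY(2,3) by (auto simp: y'(3))
      then show thesis using y' aK insert by (intro that[of y' "Inl a" "\<delta> - \<alpha> - t"]) auto
    qed
  qed
qed

text \<open>Induction on the number of unsettled nodes: each round settles one node at the cost of
  at most one step. A round may cost no step, so the length is only bounded.\<close>

lemma circuit_walk_from_settled:
  fixes E :: "('m::finite \<times> 'n::finite) set" and r :: 'm
  defines "C \<equiv> dual_transportation_circuits E r"
  assumes P: "P = dual_transportation_polyhedron E c r"
    and con: "induces_connected E UNIV"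
    and w: "w extreme_point_of P" and "y \<in> P"
    and "induces_connected E K" "K \<noteq> {}" "\<And>v. v \<in> K \<Longrightarrow> w $ v - y $ v = \<delta>"
  shows "\<exists>k z. k \<le> card (- K) \<and> circuit_walk P C y w k z"
  using assms(5-)
proof (induction "card (- K)" arbitrary: K y \<delta>)
  case 0
  then have "- K = {}" by (metis card_0_eq finite)
  then have "K = UNIV" by blast
  then have eq: "w $ v - y $ v = \<delta>" for v using 0 by blast
  \<comment> \<open>Once all nodes are settled, the normalization at r forces the common
    displacement to be 0.\<close>
  have "w $ Inl r = 0" "y $ Inl r = 0"
    using w 0 by (auto simp: extreme_point_of_def P mem_dual_transportation_polyhedron)
  then have "\<delta> = 0" using eq[of "Inl r"] by simp
  then have "y = w" using eq by (simp add: vec_eq_iff)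
  then have "circuit_walk P C y w 0 (\<lambda>_. y)" by (simp add: circuit_walk_def)
  then show ?case by blast
next
  case (Suc n)
  then have "K \<noteq> UNIV" by auto
  obtain y' z \<delta>' where y': "y' \<in> P" and step: "y' = y \<or> circuit_step P C y y'" and z: "z \<notin> K"
    and K': "induces_connected E (insert z K)"
      "\<And>v. v \<in> insert z K \<Longrightarrow> w $ v - y' $ v = \<delta>'"
    using settle_one_more_node[OF P con w \<open>y \<in> P\<close> Suc.prems(2,3) \<open>K \<noteq> UNIV\<close> Suc.prems(4)]
    unfolding C_def by metis
  have "- K = insert z (- insert z K)" using z by blast
  then have "card (- K) = Suc (card (- insert z K))" by (metis ComplD card_insert_disjoint finite insertI1)
  then have n: "n = card (- insert z K)" using Suc.hyps(2) by simp
  from Suc.hyps(1)[OF n y' K'(1) _ K'(2)] obtain k x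
    where k: "k \<le> n" "circuit_walk P C y' w k x" unfolding n by auto
  from step show ?case
  proof
    assume "y' = y"
    then show ?thesis using k Suc.hyps(2) by (metis le_SucI)
  next
    assume "circuit_step P C y y'"
    then show ?thesis using circuit_walk_Cons k Suc.hyps(2) by (metis Suc_le_mono)
  qed
qed

section \<open>The starting pair of nodes and the diameter bound\<close>

text \<open>Let x maximize d = w - v. If x is in the first class, take an edge at x tight at w: its
  slack at v is d_b - d_a, so d_b >= d_a. If x is in the second class, take an edge tight at v: its
  slack at w is d_a - d_b. Either way maximality of d at x forces equality.\<close>

lemma common_tight_edge:
  fixes E :: "('m::finite \<times> 'n::finite) set"
  assumes P: "P = dual_transportation_polyhedron E c r"
    and v: "v extreme_point_of P" and w: "w extreme_point_of P"
  obtains a b where "(a, b) \<in> E" "w $ Inl a - v $ Inl a = w $ Inr b - v $ Inr b"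
proof -
  have slack: "0 \<le> c (a, b) + w $ Inl a - w $ Inr b" "0 \<le> c (a, b) + v $ Inl a - v $ Inr b"
    if "(a, b) \<in> E" for a b
    using v w that by (auto simp: extreme_point_of_def P mem_dual_transportation_polyhedron)
  define d where "d x = w $ x - v $ x" for x
  have "Max (range d) \<in> range d" by (rule Max_in) auto
  then obtain x where x: "d x = Max (range d)" by (metis imageE)
  have max: "d z \<le> d x" for z unfolding x by simp
  \<comment> \<open>Both node classes are nonempty, so a single node is a proper cut.\<close>
  have nontriv: "{x} \<noteq> {}" "{x} \<noteq> UNIV"
    by (auto simp: set_eq_iff) (metis Inl_Inr_False)
  show thesis
  proof (cases x)
    case (Inl a0)
    obtain a b where ab: "(a, b) \<in> E" "c (a, b) + w $ Inl a - w $ Inr b = 0"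
      "Inl a \<in> {x} \<longleftrightarrow> Inr b \<notin> {x}"
      using extreme_point_tight_crossing_edge[OF w[unfolded P] nontriv] by blast
    then have "Inl a = x" using Inl by auto
    then have "d (Inr b) \<le> d (Inl a)" using max by auto
    then show thesis using slack(2)[OF ab(1)] ab(2) by (intro that[OF ab(1)]) (simp add: d_def)
  next
    case (Inr b0)
    obtain a b where ab: "(a, b) \<in> E" "c (a, b) + v $ Inl a - v $ Inr b = 0"
      "Inl a \<in> {x} \<longleftrightarrow> Inr b \<notin> {x}"
      using extreme_point_tight_crossing_edge[OF v[unfolded P] nontriv] by blast
    then have "Inr b = x" using Inr by auto
    then have "d (Inl a) \<le> d (Inr b)" using max by auto
    then show thesis using slack(1)[OF ab(1)] ab(2) by (intro that[OF ab(1)]) (simp add: d_def)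
  qed
qed

theorem theorem1:
  fixes E :: "('m::finite \<times> 'n::finite) set"
    and c :: "'m \<times> 'n \<Rightarrow> real"
    and r :: 'm
  assumes "induces_connected E (UNIV :: ('m + 'n) set)"
  shows "circuit_diameter (dual_transportation_polyhedron E c r) (dual_transportation_circuits E r)
           \<le> enat (CARD('m + 'n) - 2)"
  unfolding circuit_diameter_def
proof (rule Sup_least, clarify)
  fix v w
  define P where "P = dual_transportation_polyhedron E c r"
  let ?C = "dual_transportation_circuits E r"
  assume "v extreme_point_of dual_transportation_polyhedron E c r"
    "w extreme_point_of dual_transportation_polyhedron E c r"
  then have vw: "v extreme_point_of P" "w extreme_point_of P" by (auto simp: P_def)
  obtain a b where ab: "(a, b) \<in> E" "w $ Inl a - v $ Inl a = w $ Inr b - v $ Inr b"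
    using common_tight_edge[OF P_def vw] by blast
  \<comment> \<open>Two distinct nodes are settled from the start, which accounts for the 2
    subtracted from the number of nodes.\<close>
  define K :: "('m + 'n) set" where "K = {Inl a, Inr b}"
  have "induces_connected E K"
    using ab by (intro induces_connected_star[of "Inl a"]) (auto simp: K_def)
  moreover have "w $ x - v $ x = w $ Inl a - v $ Inl a" if "x \<in> K" for x
    using that ab by (auto simp: K_def)
  moreover have "v \<in> P" "K \<noteq> {}" using vw by (auto simp: extreme_point_of_def K_def)
  ultimately obtain k z where "k \<le> card (- K)" and walk: "circuit_walk P ?C v w k z"
    using circuit_walk_from_settled[OF P_def assms vw(2)] by metis
  moreover have "card (- K) = CARD('m + 'n) - 2"
    by (subst Compl_eq_Diff_UNIV, subst card_Diff_subset) (auto simp: K_def)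
  moreover have "circuit_dist P ?C v w \<le> enat k"
    unfolding circuit_dist_def using walk by (intro Inf_lower) blast
  ultimately show "circuit_dist (dual_transportation_polyhedron E c r) ?C v w
      \<le> enat (CARD('m + 'n) - 2)"
    unfolding P_def by (metis enat_ord_simps(1) order_trans)
qed

end
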